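(* If $\mathcal N(\mathcal T)\cap\mathcal N(\mathcal H)=\{\mathbf 0\}$, where $\mathcal N(\cdot)$ denotes the null space, then the image restoration cost $f:\mathbb R^N\to\mathbb R$, $$f(\mathbf u)=\frac12\|\mathcal T\mathbf u-\mathbf m\|^2+\rho\sum_{\mathbf r}\Big[g_q\big(\sigma_1([\mathcal H\mathbf u]_{\mathbf r})\big)+g_q\big(\sigma_2([\mathcal H\mathbf u]_{\mathbf r})\big)\Big],$$ is coercive (i.e. $f(\mathbf u)\to\infty$ as $\|\mathbf u\|\to\infty$).
   Context: Images. A square image with $N$ pixels is a vector $\mathbf u\in\mathbb R^N$; $[\mathbf u]_{\mathbf r}$ is its value at pixel location $\mathbf r$, and $\sum_{\mathbf r}$ is the sum over all $N$ pixel locations. $\mathcal T:\mathbb R^N\to\mathbb C^N$ is a linear operator (the forward model), $\mathbf m\in\mathbb C^N$ is the measurement, $\rho>0$ and $q\in(0,1)$. Discrete Hessian. $\mathbf D_{xx},\mathbf D_{xy},\mathbf D_{yx},\mathbf D_{yy}:\mathbb R^N\to\mathbb R^N$ are linear (block circulant) discrete second-derivative operators, and $\mathcal H:\mathbb R^N\to\mathbb R^{2\times2\times N}$ is the linear operator $$[\mathcal H\mathbf u]_{\mathbf r}=\begin{pmatrix}[\mathbf D_{xx}\mathbf u]_{\mathbf r}&[\mathbf D_{xy}\mathbf u]_{\mathbf r}\\ [\mathbf D_{yx}\mathbf u]_{\mathbf r}&[\mathbf D_{yy}\mathbf u]_{\mathbf r}\end{pmatrix}\in\mathbb R^{2\times2}.$$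 $\sigma_1(A),\sigma_2(A)$ denote the singular values of $A\in\mathbb R^{2\times 2}$. Shrinkage penalty. Let $s_q(x)=\max\{|x|-\rho^{2-q}|x|^{q-1},0\}\,\mathrm{sign}(x)$ (with $s_q(0)=0$). The function $g_q:\mathbb R\to\mathbb R$ is the even continuous function, strictly increasing on $[0,\infty)$ and differentiable on $(0,\infty)$, normalized by $g_q(0)=0$, whose proximal map is $s_q$, i.e. $s_q(x)=\arg\min_t\{\rho g_q(t)+\frac12(t-x)^2\}$ for all $x\in\mathbb R$. For $q\in(0,1)$ it is coercive and $g_q''<0$ on $(0,\infty)$. *)

theory Defs
  imports "HOL-Analysis.Analysis" "Berlekamp_Zassenhaus.Finite_Field"
begin

text \<open>
  A square image with \<open>N = n\<^sup>2\<close> pixels, \<open>n = CARD('n)\<close>, is a vector indexed by pairs of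
  residues modulo \<open>n\<close>, the type \<open>'n mod_ring\<close>; the group structure on the pixel grid is
  the periodic one with respect to which the derivative operators are block circulant.
\<close>

type_synonym 'n pixel = "'n mod_ring \<times> 'n mod_ring"
type_synonym 'n image = "real ^ 'n pixel"

definition null_space :: "('a \<Rightarrow> 'b::zero) \<Rightarrow> 'a set" where
  "null_space L = {u. L u = 0}"

text \<open>
  Viewed as an \<open>n \<times> n\<close> array of \<open>n \<times> n\<close> blocks (first pixel coordinate: block, second
  coordinate: position in the block), the matrix has the block \<open>C (i - k)\<close> in position \<open>(i, k)\<close>.
  The blocks themselves are arbitrary.
\<close>

definition block_circulant :: "('n::finite image \<Rightarrow> 'n image) \<Rightarrow> bool" where
  "block_circulant D \<longleftrightarrow>
    (\<exists>C :: 'n mod_ring \<Rightarrow> real ^ 'n mod_ring ^ 'n mod_ring.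
      \<forall>i j k l. matrix D $ (i, j) $ (k, l) = C (i - k) $ j $ l)"

definition hessian ::
  "('n::finite image \<Rightarrow> 'n image) \<Rightarrow> ('n image \<Rightarrow> 'n image) \<Rightarrow>
   ('n image \<Rightarrow> 'n image) \<Rightarrow> ('n image \<Rightarrow> 'n image) \<Rightarrow>
   'n image \<Rightarrow> (real ^ 2 ^ 2) ^ 'n pixel" where
  "hessian Dxx Dxy Dyx Dyy u =
    (\<chi> r. vector [vector [Dxx u $ r, Dxy u $ r], vector [Dyx u $ r, Dyy u $ r]])"

text \<open>
  The singular values of \<open>A\<close> are the square roots of the eigenvalues of \<open>A\<^sup>T A\<close>. As there are
  two of them counted with multiplicity, they come from the largest and the smallest
  eigenvalue, which coincide exactly when there is a double eigenvalue.
\<close>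

definition gram_eigenvalues :: "real ^ 2 ^ 2 \<Rightarrow> real set" where
  "gram_eigenvalues A = {\<mu>. \<exists>v. v \<noteq> 0 \<and> (transpose A ** A) *v v = \<mu> *\<^sub>R v}"

definition sigma1 :: "real ^ 2 ^ 2 \<Rightarrow> real" where
  "sigma1 A = sqrt (Max (gram_eigenvalues A))"

definition sigma2 :: "real ^ 2 ^ 2 \<Rightarrow> real" where
  "sigma2 A = sqrt (Min (gram_eigenvalues A))"

definition shrink :: "real \<Rightarrow> real \<Rightarrow> real \<Rightarrow> real" where
  "shrink \<rho> q x = max (\<bar>x\<bar> - \<rho> powr (2 - q) * \<bar>x\<bar> powr (q - 1)) 0 * sgn x"

text \<open>
  The defining properties of the penalty \<open>g\<^sub>q\<close>. The last conjunct says that \<open>shrink \<rho> q x\<close> is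
  the one and only minimizer.
\<close>

definition is_shrinkage_penalty :: "real \<Rightarrow> real \<Rightarrow> (real \<Rightarrow> real) \<Rightarrow> bool" where
  "is_shrinkage_penalty \<rho> q g \<longleftrightarrow>
    (\<forall>x. g (- x) = g x) \<and>
    continuous_on UNIV g \<and>
    strict_mono_on {0..} g \<and>
    g differentiable_on {0<..} \<and>
    g 0 = 0 \<and>
    (\<forall>x. {t. is_arg_min (\<lambda>t. \<rho> * g t + 1 / 2 * (t - x)\<^sup>2) (\<lambda>_. True) t} = {shrink \<rho> q x})"

definition restoration_cost ::
  "('n::finite image \<Rightarrow> complex ^ 'n pixel) \<Rightarrow> complex ^ 'n pixel \<Rightarrow>
   ('n image \<Rightarrow> (real ^ 2 ^ 2) ^ 'n pixel) \<Rightarrow> real \<Rightarrow> (real \<Rightarrow> real) \<Rightarrow> 'n image \<Rightarrow> real" where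
  "restoration_cost T m H \<rho> g u =
    1 / 2 * (norm (T u - m))\<^sup>2 +
    \<rho> * (\<Sum>r\<in>UNIV. g (sigma1 (H u $ r)) + g (sigma2 (H u $ r)))"

definition coercive :: "('a::real_normed_vector \<Rightarrow> real) \<Rightarrow> bool" where
  "coercive f \<longleftrightarrow> filterlim f at_top at_infinity"

end

theory Submission
  imports Defs "HOL-Real_Asymp.Real_Asymp"
begin

text \<open>
  The optimality condition of the proximal map at a point \<open>t > 0\<close> of its range identifies
  \<open>g'(t)\<close> as \<open>\<rho>\<^bsup>1-q\<^esup> x\<^bsup>q-1\<^esup>\<close>, where \<open>x\<close> is the preimage of \<open>t\<close>. As \<open>x\<close> is at most a constant
  multiple of \<open>t\<close> for \<open>t \<ge> 1\<close>, the penalty grows at least like \<open>t\<^bsup>q\<^esup>\<close>. On the other hand the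
  null space condition makes \<open>u \<mapsto> (T u, H u)\<close> injective, hence bounded below, so when \<open>u\<close>
  is large either \<open>T u\<close> is large or the Hessian at some pixel is; in the latter case its largest
  singular value, which is at least the Frobenius norm divided by \<open>\<surd>2\<close>, is large as well.
\<close>

section \<open>Growth of the shrinkage penalty\<close>

lemma shrinkage_penalty_nonneg:
  assumes "is_shrinkage_penalty \<rho> q g"
  shows "0 \<le> g x"
proof -
  have "g 0 \<le> g \<bar>x\<bar>"
    using assms by (intro strict_mono_on_leD[of "{0..}" g]) (auto simp: is_shrinkage_penalty_def)
  moreover have "g \<bar>x\<bar> = g x" "g 0 = 0"
    using assms by (auto simp: is_shrinkage_penalty_def abs_if)
  ultimately show ?thesis by simp
qed

lemma shrinkage_penalty_mono:
  assumes "is_shrinkage_penalty \<rho> q g" "0 \<le> x" "x \<le> y"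
  shows "g x \<le> g y"
  using assms by (intro strict_mono_on_leD[of "{0..}" g]) (auto simp: is_shrinkage_penalty_def)

text \<open>Intermediate value theorem on \<open>[t, t + \<rho> powr (2 - q)]\<close>. The upper
  bound later makes \<open>x\<close> comparable to \<open>t\<close>; the last equation evaluates the
  displacement \<open>x - t\<close> in the optimality condition.\<close>

lemma shrink_surj:
  assumes "\<rho> > 0" "q < 1" "1 \<le> t"
  obtains x where "t \<le> x" "x \<le> t + \<rho> powr (2 - q)" "shrink \<rho> q x = t"
    "x - t = \<rho> powr (2 - q) * x powr (q - 1)"
proof -
  define c where "c = \<rho> powr (2 - q)"
  define s where "s = (\<lambda>x. x - c * x powr (q - 1))"
  have c: "c > 0" using assms by (simp add: c_def)
  \<comment> \<open>Since \<open>t + c \<ge> 1\<close> and \<open>q - 1 < 0\<close>, the term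
    subtracted in \<open>s (t + c)\<close> is at most \<open>c\<close>, which fixes the right
    endpoint.\<close>
  have "(t + c) powr (q - 1) \<le> (t + c) powr 0"
    using assms c by (intro powr_mono) auto
  then have "c * (t + c) powr (q - 1) \<le> c * 1"
    using assms c by (intro mult_left_mono) auto
  then have "s t \<le> t" "t \<le> s (t + c)" "t \<le> t + c"
    using c assms by (auto simp: s_def)
  moreover have "continuous_on {t..t + c} s"
    unfolding s_def using assms by (intro continuous_intros) auto
  ultimately obtain x where x: "t \<le> x" "x \<le> t + c" "s x = t"
    using IVT'[of s t t "t + c"] by blast
  moreover have "shrink \<rho> q x = t"
    using x assms by (simp add: shrink_def s_def c_def max_def)
  ultimately show thesis
    using that by (simp add: s_def c_def)
qed

text \<open>\<open>t\<close> minimizes the proximal objective at its preimage \<open>x\<close>, so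
  stationarity gives \<open>\<rho> * D = x - t\<close>. Trading \<open>x\<close> for a multiple of
  \<open>t\<close> leaves a bound with an explicit antiderivative.\<close>

lemma shrinkage_penalty_deriv_ge:
  assumes g: "is_shrinkage_penalty \<rho> q g" and "\<rho> > 0" "q < 1" "1 \<le> t"
  obtains D where "(g has_real_derivative D) (at t)"
    "\<rho> powr (1 - q) * ((1 + \<rho> powr (2 - q)) * t) powr (q - 1) \<le> D"
proof -
  obtain x where x: "t \<le> x" "x \<le> t + \<rho> powr (2 - q)" "shrink \<rho> q x = t"
    "x - t = \<rho> powr (2 - q) * x powr (q - 1)"
    using shrink_surj[OF assms(2-4)] by blast
  have "g differentiable (at t within {0<..})"
    using g assms(4) by (auto simp: is_shrinkage_penalty_def differentiable_on_def)
  then have "g differentiable (at t)"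
    using assms(4) by (simp add: at_within_open[of t "{0<..}"])
  then obtain D where D: "(g has_real_derivative D) (at t)"
    using real_differentiable_def by blast
  define h where "h = (\<lambda>\<tau>. \<rho> * g \<tau> + 1 / 2 * (\<tau> - x)\<^sup>2)"
  have "is_arg_min h (\<lambda>_. True) t"
    using g x(3) unfolding is_shrinkage_penalty_def h_def by blast
  then have min: "h t \<le> h y" for y
    by (auto simp: is_arg_min_def not_less)
  have "(h has_real_derivative (\<rho> * D + (t - x))) (at t)"
    unfolding h_def by (auto intro!: derivative_eq_intros D)
  \<comment> \<open>The minimum is global, so the radius 1 is an arbitrary choice.\<close>
  then have "\<rho> * D + (t - x) = 0"
    by (rule DERIV_local_min[of _ _ _ 1]) (use min in auto)
  then have "\<rho> * D = x - t" by simp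
  also have "\<dots> = \<rho> * (\<rho> powr (1 - q) * x powr (q - 1))"
    unfolding x(4) using assms(2) powr_add[of \<rho> 1 "1 - q"] by simp
  finally have "\<rho> * D = \<rho> * (\<rho> powr (1 - q) * x powr (q - 1))" .
  then have "D = \<rho> powr (1 - q) * x powr (q - 1)"
    using assms(2) by simp
  \<comment> \<open>Here \<open>t \<ge> 1\<close> turns the additive constant into a multiple of
    \<open>t\<close>; the negative exponent then reverses the inequality.\<close>
  moreover have "\<rho> powr (2 - q) * 1 \<le> \<rho> powr (2 - q) * t"
    using assms by (intro mult_left_mono) auto
  then have "x \<le> (1 + \<rho> powr (2 - q)) * t"
    using x by (simp add: algebra_simps)
  then have "((1 + \<rho> powr (2 - q)) * t) powr (q - 1) \<le> x powr (q - 1)"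
    using x assms by (intro powr_mono2') auto
  ultimately show thesis
    using that[OF D] by (simp add: mult_left_mono)
qed

text \<open>The derivative of \<open>g\<close> dominates that of \<open>K / q * t powr q\<close> on
  \<open>[1, \<infinity>)\<close>, so the difference of the two is nondecreasing there.\<close>

lemma shrinkage_penalty_at_top:
  assumes g: "is_shrinkage_penalty \<rho> q g" and "\<rho> > 0" "0 < q" "q < 1"
  shows "filterlim g at_top at_top"
proof -
  define K where "K = \<rho> powr (1 - q) * (1 + \<rho> powr (2 - q)) powr (q - 1)"
  have "1 + \<rho> powr (2 - q) > 0"
    by (simp add: add_pos_nonneg)
  then have K: "K > 0"
    using assms by (simp add: K_def)
  have growth: "K / q * t powr q - K / q \<le> g t" if "1 \<le> t" for t
  proof -
    have "\<exists>d. ((\<lambda>t. g t - K / q * t powr q) has_real_derivative d) (at x) \<and> 0 \<le> d" if "1 \<le> x" for x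
    proof -
      obtain D where D: "(g has_real_derivative D) (at x)"
        "\<rho> powr (1 - q) * ((1 + \<rho> powr (2 - q)) * x) powr (q - 1) \<le> D"
        using shrinkage_penalty_deriv_ge[OF g assms(2,4) \<open>1 \<le> x\<close>] by blast
      have "((\<lambda>t. g t - K / q * t powr q) has_real_derivative (D - K * x powr (q - 1))) (at x)"
        using that assms by (auto intro!: derivative_eq_intros D(1))
      moreover have "K * x powr (q - 1) \<le> D"
        using D(2) that by (simp add: K_def powr_mult mult.assoc)
      ultimately show ?thesis by (intro exI[of _ "D - K * x powr (q - 1)"]) auto
    qed
    then have "g 1 - K / q * 1 powr q \<le> g t - K / q * t powr q"
      by (intro DERIV_nonneg_imp_nondecreasing[OF that, of "\<lambda>t. g t - K / q * t powr q"]) blast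
    then show ?thesis
      using shrinkage_penalty_nonneg[OF g, of 1] by simp
  qed
  have "filterlim (\<lambda>t. - (K / q) + K / q * t powr q) at_top at_top"
    using K assms
    by (intro filterlim_tendsto_add_at_top[OF tendsto_const]
        filterlim_tendsto_pos_mult_at_top[OF tendsto_const] real_powr_at_top) auto
  then show ?thesis
    by (rule filterlim_at_top_mono)
      (use growth in \<open>auto simp: eventually_at_top_linorder intro!: exI[of _ 1]\<close>)
qed

section \<open>The largest singular value\<close>

text \<open>The quadratic is the characteristic polynomial of \<open>transpose A ** A\<close>: the
  norm is the Frobenius norm, so its square is the trace of the Gram matrix.\<close>

lemma gram_eigenvalues_eq:
  fixes A :: "real ^ 2 ^ 2"
  shows "gram_eigenvalues A =
    {\<mu>. \<mu>\<^sup>2 - (norm A)\<^sup>2 * \<mu> + (det A)\<^sup>2 = 0}"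
proof -
  have "\<mu> \<in> gram_eigenvalues A \<longleftrightarrow> det (transpose A ** A - mat \<mu>) = 0" for \<mu>
  proof -
    have "(transpose A ** A) *v v = \<mu> *\<^sub>R v \<longleftrightarrow> (transpose A ** A - mat \<mu>) *v v = 0" for v :: "real ^ 2"
      by (simp add: matrix_vector_mult_diff_rdistrib vec_eq_iff forall_2 matrix_vector_mult_def
          sum_2 mat_def) argo
    then show ?thesis
      unfolding gram_eigenvalues_def
      using invertible_det_nz[of "transpose A ** A - mat \<mu>"]
        matrix_left_invertible_ker[of "transpose A ** A - mat \<mu>"]
        invertible_left_inverse[of "transpose A ** A - mat \<mu>"] by auto
  qed
  moreover have "det (transpose A ** A - mat \<mu>) = \<mu>\<^sup>2 - (norm A)\<^sup>2 * \<mu> + (det A)\<^sup>2" for \<mu>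
    by (simp add: det_2 matrix_matrix_mult_def transpose_def mat_def sum_2 power2_norm_eq_inner
        inner_vec_def) (simp add: algebra_simps power2_eq_square)
  ultimately show ?thesis by auto
qed

text \<open>The larger root of the characteristic polynomial is at least half the sum of the roots,
  and that sum is \<open>(norm A)\<^sup>2\<close>.\<close>

lemma sigma1_ge:
  fixes A :: "real ^ 2 ^ 2"
  shows "norm A / sqrt 2 \<le> sigma1 A"
proof -
  define p where "p = (norm A)\<^sup>2"
  define d where "d = det A"
  have p: "p = (A$1$1)\<^sup>2 + (A$1$2)\<^sup>2 + (A$2$1)\<^sup>2 + (A$2$2)\<^sup>2"
    unfolding p_def power2_norm_eq_inner by (simp add: inner_vec_def sum_2 power2_eq_square)
  \<comment> \<open>The two sums of squares expand to \<open>p - 2 * d\<close> and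
    \<open>p + 2 * d\<close>, whence the discriminant is nonnegative.\<close>
  have "0 \<le> (A$1$1 - A$2$2)\<^sup>2 + (A$1$2 + A$2$1)\<^sup>2" "0 \<le> (A$1$1 + A$2$2)\<^sup>2 + (A$1$2 - A$2$1)\<^sup>2"
    by auto
  then have "2 * d \<le> p" "- (2 * d) \<le> p"
    unfolding p d_def det_2 by (auto simp: algebra_simps power2_eq_square)
  then have "\<bar>2 * d\<bar> \<le> \<bar>p\<bar>" by linarith
  then have "(2 * d)\<^sup>2 \<le> p\<^sup>2" by (simp only: abs_le_square_iff)
  then have disc: "0 \<le> p\<^sup>2 - 4 * d\<^sup>2" by (simp add: power_mult_distrib)
  define \<mu> where "\<mu> = (p + sqrt (p\<^sup>2 - 4 * d\<^sup>2)) / 2"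
  have "(sqrt (p\<^sup>2 - 4 * d\<^sup>2))\<^sup>2 = p\<^sup>2 - 4 * d\<^sup>2" using disc by simp
  then have "\<mu>\<^sup>2 - p * \<mu> + d\<^sup>2 = 0"
    unfolding \<mu>_def by (simp add: field_simps power2_eq_square)
  then have \<mu>: "\<mu> \<in> gram_eigenvalues A"
    by (simp add: gram_eigenvalues_eq p_def d_def)
  \<comment> \<open>Finiteness is what makes \<open>Max\<close> an upper bound; by Vieta the other
    root is \<open>p - \<mu>\<close>.\<close>
  have "finite (gram_eigenvalues A)"
  proof (rule finite_subset)
    show "gram_eigenvalues A \<subseteq> {\<mu>, p - \<mu>}"
    proof
      fix x assume "x \<in> gram_eigenvalues A"
      then have "x\<^sup>2 - p * x + d\<^sup>2 = 0"
        by (simp add: gram_eigenvalues_eq p_def d_def)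
      with \<open>\<mu>\<^sup>2 - p * \<mu> + d\<^sup>2 = 0\<close> have "(x - \<mu>) * (x - (p - \<mu>)) = 0"
        by (simp add: algebra_simps power2_eq_square)
      then show "x \<in> {\<mu>, p - \<mu>}" by auto
    qed
  qed simp
  then have "\<mu> \<le> Max (gram_eigenvalues A)"
    using \<mu> by simp
  moreover have "p / 2 \<le> \<mu>" using disc by (simp add: \<mu>_def)
  ultimately have "sqrt (p / 2) \<le> sigma1 A"
    by (simp add: sigma1_def)
  then show ?thesis
    by (simp add: p_def real_sqrt_divide)
qed

section \<open>Coercivity of the cost\<close>

lemma linear_hessian:
  assumes "linear Dxx" "linear Dxy" "linear Dyx" "linear Dyy"
  shows "linear (hessian Dxx Dxy Dyx Dyy)"
  by (rule linearI)
    (simp_all add: hessian_def vec_eq_iff forall_2 linear_add[OF assms(1)] linear_add[OF assms(2)]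
      linear_add[OF assms(3)] linear_add[OF assms(4)] linear_scale[OF assms(1)]
      linear_scale[OF assms(2)] linear_scale[OF assms(3)] linear_scale[OF assms(4)])

lemma linear_pair_bounded_below:
  fixes S :: "'a::euclidean_space \<Rightarrow> 'b::euclidean_space" and H :: "'a \<Rightarrow> 'c::euclidean_space"
  assumes S: "linear S" and H: "linear H" and null: "null_space S \<inter> null_space H = {0}"
  obtains B where "B > 0" "\<And>u. B * norm u \<le> norm (S u) + norm (H u)"
proof -
  have lin: "linear (\<lambda>u. (S u, H u))"
    by (rule linearI) (simp_all add: linear_add[OF S] linear_add[OF H] linear_scale[OF S]
        linear_scale[OF H])
  have "inj (\<lambda>u. (S u, H u))"
    using null unfolding linear_injective_0[OF lin] null_space_def zero_prod_def by blast
  then obtain B where B: "B > 0" "\<And>u. B * norm u \<le> norm (S u, H u)"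
    using linear_inj_bounded_below_pos[OF lin] by blast
  have "B * norm u \<le> norm (S u) + norm (H u)" for u
    using B(2)[of u] norm_Pair_le order_trans by blast
  with B(1) that show thesis by blast
qed

text \<open>The norm is at most the sum of the component norms, so some component reaches the
  average share.\<close>

lemma exists_large_component:
  fixes x :: "'a::real_normed_vector ^ 'n"
  obtains r where "norm x \<le> real CARD('n) * norm (x $ r)"
proof -
  have "\<exists>r. norm x \<le> real CARD('n) * norm (x $ r)"
  proof (rule ccontr)
    assume "\<nexists>r. norm x \<le> real CARD('n) * norm (x $ r)"
    then have "real CARD('n) * norm (x $ r) < norm x" for r
      by (simp add: not_le)
    then have "(\<Sum>r\<in>UNIV. real CARD('n) * norm (x $ r)) < (\<Sum>r\<in>(UNIV :: 'n set). norm x)"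
      by (intro sum_strict_mono) auto
    also have "\<dots> = real CARD('n) * norm x" by simp
    finally have "(\<Sum>r\<in>UNIV. norm (x $ r)) < norm x"
      by (simp flip: sum_distrib_left)
    moreover have "norm x \<le> (\<Sum>r\<in>UNIV. norm (x $ r))"
      unfolding norm_vec_def by (intro L2_set_le_sum) auto
    ultimately show False by simp
  qed
  with that show thesis by blast
qed

lemma restoration_cost_ge_data:
  assumes "is_shrinkage_penalty \<rho> q g" "\<rho> > 0"
  shows "1 / 2 * (norm (T u - m))\<^sup>2 \<le> restoration_cost T m H \<rho> g u"
  unfolding restoration_cost_def
  using assms by (simp add: sum_nonneg shrinkage_penalty_nonneg)

lemma restoration_cost_ge_penalty:
  assumes g: "is_shrinkage_penalty \<rho> q g" and "\<rho> > 0"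
  shows "\<rho> * g (norm (H u $ r) / sqrt 2) \<le> restoration_cost T m H \<rho> g u"
proof -
  note nn = shrinkage_penalty_nonneg[OF g]
  have "g (norm (H u $ r) / sqrt 2) \<le> g (sigma1 (H u $ r))"
    by (intro shrinkage_penalty_mono[OF g] sigma1_ge) auto
  also have "\<dots> \<le> g (sigma1 (H u $ r)) + g (sigma2 (H u $ r))"
    using nn by simp
  also have "\<dots> \<le> (\<Sum>r\<in>UNIV. g (sigma1 (H u $ r)) + g (sigma2 (H u $ r)))"
    using nn by (intro member_le_sum) auto
  finally show ?thesis
    using assms(2) by (auto simp: restoration_cost_def intro!: add_increasing)
qed

theorem lemma1:
  fixes T :: "'n::finite image \<Rightarrow> complex ^ 'n pixel"
    and m :: "complex ^ 'n pixel"
    and Dxx Dxy Dyx Dyy :: "'n image \<Rightarrow> 'n image"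
    and \<rho> q :: real
    and g :: "real \<Rightarrow> real"
  assumes "linear T"
    and "linear Dxx" "linear Dxy" "linear Dyx" "linear Dyy"
    and "block_circulant Dxx" "block_circulant Dxy" "block_circulant Dyx" "block_circulant Dyy"
    and "\<rho> > 0" and "0 < q" "q < 1"
    and "is_shrinkage_penalty \<rho> q g"
    and "null_space T \<inter> null_space (hessian Dxx Dxy Dyx Dyy) = {0}"
  shows "coercive (restoration_cost T m (hessian Dxx Dxy Dyx Dyy) \<rho> g)"
proof -
  let ?H = "hessian Dxx Dxy Dyx Dyy"
  let ?f = "restoration_cost T m ?H \<rho> g"
  note g = \<open>is_shrinkage_penalty \<rho> q g\<close>
  obtain B where B: "B > 0" "\<And>u. B * norm u \<le> norm (T u) + norm (?H u)"
    using linear_pair_bounded_below[OF assms(1) linear_hessian[OF assms(2-5)] assms(14)] by blast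
  define N where "N = real CARD('n pixel)"
  have N: "N > 0" unfolding N_def by simp
  \<comment> \<open>\<open>a\<close> bounds the cost when \<open>T u\<close> carries half of
    \<open>B * norm u\<close>, \<open>b\<close> when the Hessian does; in \<open>b\<close>, the
    factor \<open>N\<close> pays for passing to one pixel and \<open>sqrt 2\<close> for passing to
    \<open>sigma1\<close>.\<close>
  define a where "a = (\<lambda>t. 1 / 2 * (- norm m + B / 2 * t)\<^sup>2)"
  define b where "b = (\<lambda>t. \<rho> * g (B / (2 * N * sqrt 2) * t))"
  have a_lim: "filterlim a at_top at_top"
    unfolding a_def using B(1)
    by (intro filterlim_tendsto_pos_mult_at_top[OF tendsto_const] filterlim_pow_at_top
        filterlim_tendsto_add_at_top[OF tendsto_const] filterlim_ident) auto
  have b_lim: "filterlim b at_top at_top"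
    unfolding b_def using B(1) N assms(10)
    by (intro filterlim_tendsto_pos_mult_at_top[OF tendsto_const]
        filterlim_compose[OF shrinkage_penalty_at_top[OF g assms(10-12)]] filterlim_ident) auto
  \<comment> \<open>The threshold makes the base of the square in \<open>a\<close> nonnegative, so
    squaring is monotone. Which case applies depends on \<open>u\<close>, hence the minimum.\<close>
  have bound: "min (a (norm u)) (b (norm u)) \<le> ?f u" if u: "2 * norm m / B \<le> norm u" for u
  proof (cases "B / 2 * norm u \<le> norm (T u)")
    case True
    have "0 \<le> - norm m + B / 2 * norm u"
      using u B(1) by (simp add: field_simps)
    moreover have "- norm m + B / 2 * norm u \<le> norm (T u - m)"
      using True norm_triangle_ineq2[of "T u" m] by linarith
    ultimately have "a (norm u) \<le> 1 / 2 * (norm (T u - m))\<^sup>2"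
      unfolding a_def by (simp add: power_mono)
    also have "\<dots> \<le> ?f u"
      by (rule restoration_cost_ge_data[OF g assms(10)])
    finally show ?thesis by simp
  next
    case False
    obtain r where r: "norm (?H u) \<le> N * norm (?H u $ r)"
      unfolding N_def by (rule exists_large_component)
    have "B / 2 * norm u \<le> N * norm (?H u $ r)"
      using False B(2)[of u] r by linarith
    then have "B / (2 * N * sqrt 2) * norm u \<le> norm (?H u $ r) / sqrt 2"
      using N by (simp add: field_simps)
    then have "b (norm u) \<le> \<rho> * g (norm (?H u $ r) / sqrt 2)"
      unfolding b_def using B(1) N assms(10)
      by (intro mult_left_mono shrinkage_penalty_mono[OF g]) auto
    also have "\<dots> \<le> ?f u"
      by (rule restoration_cost_ge_penalty[OF g assms(10)])
    finally show ?thesis by simp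
  qed
  have "filterlim (\<lambda>t. min (a t) (b t)) at_top at_top"
    using a_lim b_lim unfolding filterlim_at_top by (auto intro: eventually_conj)
  then have "filterlim (\<lambda>u :: 'n image. min (a (norm u)) (b (norm u))) at_top at_infinity"
    by (rule filterlim_compose[OF _ filterlim_norm_at_top])
  moreover have "\<forall>\<^sub>F u in at_infinity. min (a (norm u)) (b (norm u)) \<le> ?f u"
    using bound by (auto simp: eventually_at_infinity)
  ultimately show ?thesis
    unfolding coercive_def by (rule filterlim_at_top_mono)
qed

end
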